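(* For every hypergraph $\mathcal{H}$, it holds that $\mathcal{H}$ is threshold if and only if its split-incidence graph $SI(\mathcal{H})$ is total domishold.
   Context: A hypergraph is a pair $\mathcal{H}=(\mathcal{V},\mathcal{E})$ where $\mathcal{V}$ is a finite set of vertices and $\mathcal{E}$ is a finite multiset of subsets of $\mathcal{V}$ (hyperedges; multiple edges are allowed). $\mathbb{R}_+$ is the set of non-negative reals. $\mathcal{H}$ is threshold if there exist $w:\mathcal{V}\to\mathbb{R}_+$ and a real number $t$ such that for all $X\subseteq\mathcal{V}$: $w(X):=\sum_{x\in X}w(x)\le t$ if and only if $X$ contains no hyperedge of $\mathcal{H}$. The split-incidence graph $SI(\mathcal{H})$ is the graph with vertex set the disjoint union $\mathcal{V}\cup\mathcal{E}'$, where $\mathcal{E}'=\{e'\mid e\in\mathcal{E}\}$ (one vertex $e'$ per hyperedge $e$, counted with multiplicity), $\mathcal{V}$ is a clique, $\mathcal{E}'$ is an independent set, and $v\in\mathcal{V}$ is adjacent to $e'\in\mathcal{E}'$ if and only if $v\in e$. A total dominating set in a finite simple graph $G=(V,E)$ is a set $D\subseteq V$ such that every vertex of $G$ has a neighbor in $D$. $G$ is total domishold if there exist $w:V\to\mathbb{R}_+$ and $t\in\mathbb{R}_+$ such that for every $S\subseteq V$, $\sum_{x\in S}w(x)\ge t$ if and only if $S$ is a total dominating set in $G$ (isolated vertices are allowed). *)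

theory Defs
  imports "HOL-Library.Multiset" "Graph_Theory.Pair_Digraph"
begin

locale hypergraph =
  fixes V :: "'a set" and E :: "'a set multiset"
  assumes finite_verts: "finite V"
    and edge_subset: "e \<in># E \<Longrightarrow> e \<subseteq> V"

definition threshold_hypergraph :: "'a set \<Rightarrow> 'a set multiset \<Rightarrow> bool" where
  "threshold_hypergraph V E \<longleftrightarrow>
     (\<exists>(w :: 'a \<Rightarrow> real) (t :: real). (\<forall>x\<in>V. 0 \<le> w x) \<and>
        (\<forall>X. X \<subseteq> V \<longrightarrow> ((\<Sum>x\<in>X. w x) \<le> t \<longleftrightarrow> \<not> (\<exists>e. e \<in># E \<and> e \<subseteq> X))))"

(* The hyperedge e with multiplicity m contributes m distinct vertices
   Inr (e, 0), ..., Inr (e, m - 1). *)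
definition hyperedge_copies :: "'a set multiset \<Rightarrow> ('a set \<times> nat) set" where
  "hyperedge_copies E = {(e, i). i < count E e}"

(* An undirected edge is represented by its two arcs, as in the locale pair_graph. *)
definition split_incidence_graph ::
    "'a set \<Rightarrow> 'a set multiset \<Rightarrow> ('a + 'a set \<times> nat) pair_pre_digraph" where
  "split_incidence_graph V E =
     \<lparr> pverts = Inl ` V \<union> Inr ` hyperedge_copies E,
       parcs = {(Inl u, Inl v) | u v. u \<in> V \<and> v \<in> V \<and> u \<noteq> v}
             \<union> {(Inl v, Inr (e, i)) | v e i. v \<in> V \<and> (e, i) \<in> hyperedge_copies E \<and> v \<in> e}
             \<union> {(Inr (e, i), Inl v) | v e i. v \<in> V \<and> (e, i) \<in> hyperedge_copies E \<and> v \<in> e} \<rparr>"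

definition total_dominating_set :: "'v pair_pre_digraph \<Rightarrow> 'v set \<Rightarrow> bool" where
  "total_dominating_set G D \<longleftrightarrow>
     D \<subseteq> pverts G \<and> (\<forall>v\<in>pverts G. \<exists>u\<in>D. (v, u) \<in> parcs G)"

definition total_domishold :: "'v pair_pre_digraph \<Rightarrow> bool" where
  "total_domishold G \<longleftrightarrow>
     (\<exists>(w :: 'v \<Rightarrow> real) (t :: real). (\<forall>x\<in>pverts G. 0 \<le> w x) \<and> 0 \<le> t \<and>
        (\<forall>S. S \<subseteq> pverts G \<longrightarrow> ((\<Sum>x\<in>S. w x) \<ge> t \<longleftrightarrow> total_dominating_set G S)))"

lemma finite_hyperedge_copies: "finite (hyperedge_copies E)"
proof -
  have "hyperedge_copies E = (SIGMA e:set_mset E. {..<count E e})"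
    unfolding hyperedge_copies_def by (auto simp: count_greater_zero_iff[symmetric] simp del: count_greater_zero_iff)
  then show ?thesis by simp
qed

lemma (in hypergraph) pair_graph_split_incidence_graph:
  "pair_graph (split_incidence_graph V E)"
proof -
  let ?G = "split_incidence_graph V E"
  have fin: "finite (pverts ?G)"
    using finite_verts by (simp add: split_incidence_graph_def finite_hyperedge_copies finite_imageI)
  have sub: "parcs ?G \<subseteq> pverts ?G \<times> pverts ?G"
    by (auto simp: split_incidence_graph_def)
  have sym: "symmetric (with_proj ?G)"
    unfolding symmetric_def by (auto simp: split_incidence_graph_def intro!: symI)
  have loopfree: "fst a \<noteq> snd a" if "a \<in> parcs ?G" for a
    using that by (auto simp: split_incidence_graph_def)
  have finarcs: "finite (parcs ?G)"
    using fin sub by (meson finite_SigmaI finite_subset)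
  show ?thesis
    by unfold_locales (use fin finarcs sub sym loopfree in auto)
qed

end

theory Submission
  imports Defs
begin

text \<open>
  Both sides are statements about linear separability of one monotone family: the transversals
  of the hypergraph, that is, the vertex sets that meet every hyperedge.

  Taking complements in \<open>V\<close> turns "contains no hyperedge" into "is a transversal" and an upper
  bound on the weight into a lower bound, so the hypergraph is threshold iff its transversals are
  exactly the sets of weight at least some \<open>T \<ge> 0\<close>
  (\<open>threshold_hypergraph_iff_transversal_weights\<close>). On the graph side, if \<open>V \<noteq> {}\<close>, the
  total dominating sets are exactly the sets of at least two vertices whose trace on \<open>V\<close> is a
  transversal (\<open>total_dominating_set_split_incidence_graph\<close>).

  Weights for the graph give weights for the hypergraph by restriction to \<open>V\<close>, because adding all
  hyperedge copies to a transversal makes the cardinality requirement harmless (if there are no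
  hyperedges, every set is a transversal and zero weights will do). Conversely, given weights and a
  bound \<open>T\<close> for transversals, cap the weights at \<open>T\<close>, give hyperedge copies weight 0, then add a
  small \<open>\<epsilon>\<close> to the weight of every graph vertex and raise the bound to \<open>T + 2 \<epsilon>\<close>.
  The term \<open>2 \<epsilon>\<close> enforces the cardinality requirement (capping is what makes a single heavy
  vertex fall short), and for small \<open>\<epsilon>\<close> the added weights cannot lift a non-transversal to the
  bound.
\<close>

definition transversal :: "'a set multiset \<Rightarrow> 'a set \<Rightarrow> bool" where
  "transversal E A \<longleftrightarrow> (\<forall>e. e \<in># E \<longrightarrow> e \<inter> A \<noteq> {})"

definition transversal_weights ::
    "'a set \<Rightarrow> 'a set multiset \<Rightarrow> ('a \<Rightarrow> real) \<Rightarrow> real \<Rightarrow> bool" where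
  "transversal_weights V E w T \<longleftrightarrow>
     (\<forall>x\<in>V. 0 \<le> w x) \<and> 0 \<le> T \<and> (\<forall>A. A \<subseteq> V \<longrightarrow> (T \<le> sum w A \<longleftrightarrow> transversal E A))"

lemma (in hypergraph) transversal_iff_complement:
  "transversal E A \<longleftrightarrow> \<not> (\<exists>e. e \<in># E \<and> e \<subseteq> V - A)"
  using edge_subset unfolding transversal_def by blast

lemma (in hypergraph) threshold_hypergraph_iff_transversal_weights:
  "threshold_hypergraph V E \<longleftrightarrow> (\<exists>w T. transversal_weights V E w T)"
proof
  assume "threshold_hypergraph V E"
  then obtain w :: "'a \<Rightarrow> real" and t where w: "\<forall>x\<in>V. 0 \<le> w x"
    and t: "\<And>X. X \<subseteq> V \<Longrightarrow> sum w X \<le> t \<longleftrightarrow> \<not> (\<exists>e. e \<in># E \<and> e \<subseteq> X)"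
    unfolding threshold_hypergraph_def by blast
  \<comment> \<open>The difference can be negative when \<open>E\<close> is empty. The bound can then be raised to 0,
      below which no weight lies.\<close>
  let ?T = "max 0 (sum w V - t)"
  have "?T \<le> sum w A \<longleftrightarrow> transversal E A" if "A \<subseteq> V" for A
  proof -
    have "0 \<le> sum w A"
      using w that by (intro sum_nonneg) auto
    moreover have "sum w (V - A) = sum w V - sum w A"
      using finite_verts that by (simp add: sum_diff finite_subset)
    ultimately show ?thesis
      using t[of "V - A"] transversal_iff_complement[of A] by auto
  qed
  then show "\<exists>w T. transversal_weights V E w T"
    using w unfolding transversal_weights_def by (metis max.cobounded1)
next
  assume "\<exists>w T. transversal_weights V E w T"
  then obtain w :: "'a \<Rightarrow> real" and T where w: "\<forall>x\<in>V. 0 \<le> w x"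
    and T: "\<And>A. A \<subseteq> V \<Longrightarrow> T \<le> sum w A \<longleftrightarrow> transversal E A"
    unfolding transversal_weights_def by blast
  have "sum w X \<le> sum w V - T \<longleftrightarrow> \<not> (\<exists>e. e \<in># E \<and> e \<subseteq> X)" if "X \<subseteq> V" for X
  proof -
    have "sum w (V - X) = sum w V - sum w X"
      using finite_verts that by (simp add: sum_diff finite_subset)
    moreover have "V - (V - X) = X"
      using that by blast
    ultimately show ?thesis
      using T[of "V - X"] transversal_iff_complement[of "V - X"] by auto
  qed
  then show "threshold_hypergraph V E"
    using w unfolding threshold_hypergraph_def by blast
qed

lemma hyperedge_copies_empty_iff [simp]: "hyperedge_copies E = {} \<longleftrightarrow> E = {#}"
proof
  assume "hyperedge_copies E = {}"
  then have "count E e = 0" for e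
    unfolding hyperedge_copies_def by (metis (mono_tags, lifting) case_prodI empty_iff
        mem_Collect_eq not_gr_zero)
  then show "E = {#}"
    by (simp add: multiset_eq_iff)
qed (simp add: hyperedge_copies_def)

lemma pverts_split_incidence_graph:
  "pverts (split_incidence_graph V E) = V <+> hyperedge_copies E"
  by (simp add: split_incidence_graph_def Plus_def)

lemma arcs_split_incidence_graph:
  "(Inl u, Inl v) \<in> parcs (split_incidence_graph V E) \<longleftrightarrow> u \<in> V \<and> v \<in> V \<and> u \<noteq> v"
  "(Inl v, Inr (e, i)) \<in> parcs (split_incidence_graph V E) \<longleftrightarrow>
     v \<in> V \<and> (e, i) \<in> hyperedge_copies E \<and> v \<in> e"
  "(Inr (e, i), Inl v) \<in> parcs (split_incidence_graph V E) \<longleftrightarrow>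
     v \<in> V \<and> (e, i) \<in> hyperedge_copies E \<and> v \<in> e"
  "(Inr p, Inr q) \<notin> parcs (split_incidence_graph V E)"
  by (auto simp: split_incidence_graph_def)

lemma Plus_vimage: "(Inl -` D) <+> (Inr -` D) = D"
proof (rule set_eqI)
  fix x :: "'a + 'b"
  show "x \<in> (Inl -` D) <+> (Inr -` D) \<longleftrightarrow> x \<in> D"
    by (cases x) auto
qed

text \<open>
  A copy of a hyperedge \<open>e\<close> has a neighbour in \<open>D\<close> iff \<open>D\<close> meets \<open>e\<close>. A member of \<open>D\<close> never
  dominates itself, so two members are necessary as soon as there is something to dominate.
  They also suffice: to dominate \<open>v \<in> V\<close>, take a member of \<open>D\<close> other than \<open>v\<close>. If it is a copy of
  a hyperedge \<open>e\<close>, the transversal contains some \<open>x \<in> e\<close>; either \<open>x \<noteq> v\<close> is adjacent to \<open>v\<close> in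
  the clique, or \<open>v = x\<close> lies in \<open>e\<close> and is adjacent to the copy itself.
\<close>
lemma (in hypergraph) total_dominating_set_split_incidence_graph:
  assumes "V \<noteq> {}" and D: "D \<subseteq> pverts (split_incidence_graph V E)"
  shows "total_dominating_set (split_incidence_graph V E) D \<longleftrightarrow>
           transversal E (Inl -` D) \<and> 2 \<le> card D"
proof
  interpret G: pair_graph "split_incidence_graph V E"
    by (rule pair_graph_split_incidence_graph)
  assume "total_dominating_set (split_incidence_graph V E) D"
  then have dom: "\<exists>u\<in>D. (v, u) \<in> parcs (split_incidence_graph V E)"
    if "v \<in> pverts (split_incidence_graph V E)" for v
    using that unfolding total_dominating_set_def by blast
  have "e \<inter> Inl -` D \<noteq> {}" if "e \<in># E" for e
  proof -
    have "Inr (e, 0) \<in> pverts (split_incidence_graph V E)"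
      using that by (auto simp: pverts_split_incidence_graph hyperedge_copies_def)
    from dom[OF this] obtain u where
      u: "u \<in> D" "(Inr (e, 0), u) \<in> parcs (split_incidence_graph V E)" by blast
    then show ?thesis
      by (cases u) (auto simp: arcs_split_incidence_graph)
  qed
  moreover have "2 \<le> card D"
  proof -
    obtain v where "v \<in> V"
      using assms by blast
    then obtain u where u: "u \<in> D"
      using dom[of "Inl v"] by (auto simp: pverts_split_incidence_graph)
    then obtain u' where u': "u' \<in> D" "(u, u') \<in> parcs (split_incidence_graph V E)"
      using dom D by blast
    then have "u \<noteq> u'"
      using G.no_loops by fastforce
    then have "card {u, u'} = 2"
      by simp
    moreover have "finite D"
      using D G.pair_finite_verts by (rule finite_subset)
    ultimately show ?thesis
      using u u' by (metis card_mono empty_subsetI insert_subset)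
  qed
  ultimately show "transversal E (Inl -` D) \<and> 2 \<le> card D"
    unfolding transversal_def by blast
next
  assume asm: "transversal E (Inl -` D) \<and> 2 \<le> card D"
  have meet: "\<exists>x\<in>e. x \<in> V \<and> Inl x \<in> D" if "(e, i) \<in> hyperedge_copies E" for e i
  proof -
    have "e \<in># E"
      using that by (auto simp: hyperedge_copies_def intro: count_inI)
    then show ?thesis
      using asm D unfolding transversal_def pverts_split_incidence_graph by blast
  qed
  have "\<exists>u\<in>D. (y, u) \<in> parcs (split_incidence_graph V E)"
    if y: "y \<in> pverts (split_incidence_graph V E)" for y
  proof (cases y)
    case (Inr p)
    then obtain e i where "y = Inr (e, i)" "(e, i) \<in> hyperedge_copies E"
      using y by (cases p) (auto simp: pverts_split_incidence_graph)
    moreover from this obtain x where "x \<in> e" "x \<in> V" "Inl x \<in> D"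
      using meet by blast
    ultimately show ?thesis
      by (intro bexI[of _ "Inl x"]) (simp_all add: arcs_split_incidence_graph)
  next
    case (Inl v)
    then have v: "v \<in> V"
      using y by (auto simp: pverts_split_incidence_graph)
    have "\<not> D \<subseteq> {Inl v}"
      using asm card_mono[of "{Inl v}" D] by auto
    then obtain u where u: "u \<in> D" "u \<noteq> Inl v"
      by blast
    show ?thesis
    proof (cases u)
      case (Inl x)
      then show ?thesis
        using u v D \<open>y = Inl v\<close>
        by (intro bexI[of _ u]) (auto simp: arcs_split_incidence_graph pverts_split_incidence_graph)
    next
      case (Inr p)
      then obtain e i where e: "u = Inr (e, i)" "(e, i) \<in> hyperedge_copies E"
        using u D by (cases p) (auto simp: pverts_split_incidence_graph)
      then obtain x where "x \<in> e" "x \<in> V" "Inl x \<in> D"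
        using meet by blast
      then show ?thesis
        using e u v \<open>y = Inl v\<close>
        by (cases "x = v") (auto simp: arcs_split_incidence_graph intro: bexI[of _ "Inl x"] bexI[of _ u])
    qed
  qed
  then show "total_dominating_set (split_incidence_graph V E) D"
    using D unfolding total_dominating_set_def by blast
qed

text \<open>
  A set with no element of weight above \<open>T\<close> keeps its weight under capping, and any other set has
  weight at least \<open>T\<close> before and after. Hence weights may be assumed to be at most \<open>T\<close>.
\<close>
lemma transversal_weights_cap:
  assumes "finite V" and "transversal_weights V E w T"
  shows "transversal_weights V E (\<lambda>x. min (w x) T) T"
proof -
  have w: "\<And>x. x \<in> V \<Longrightarrow> 0 \<le> w x" and "0 \<le> T"
    using assms(2) unfolding transversal_weights_def by auto
  have "T \<le> (\<Sum>x\<in>A. min (w x) T) \<longleftrightarrow> T \<le> sum w A" if A: "A \<subseteq> V" for A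
  proof (cases "\<exists>x\<in>A. T < w x")
    case True
    then obtain x where x: "x \<in> A" "T < w x"
      by blast
    have "finite A"
      using assms(1) A finite_subset by blast
    then have "w x \<le> sum w A" "min (w x) T \<le> (\<Sum>x\<in>A. min (w x) T)"
      using x A w \<open>0 \<le> T\<close> member_le_sum[of x A w]
        member_le_sum[of x A "\<lambda>x. min (w x) T"] by auto
    then show ?thesis
      using x by auto
  next
    case False
    then have "(\<Sum>x\<in>A. min (w x) T) = sum w A"
      by (intro sum.cong) auto
    then show ?thesis
      by simp
  qed
  then show ?thesis
    using assms(2) unfolding transversal_weights_def by auto
qed

lemma finite_uniform_gap:
  fixes f :: "'b \<Rightarrow> real"
  assumes "finite S" and "\<And>x. x \<in> S \<Longrightarrow> f x < c"
  shows "\<exists>\<delta>>0. \<forall>x\<in>S. f x \<le> c - \<delta>"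
proof -
  let ?\<delta> = "Min (insert 1 ((\<lambda>x. c - f x) ` S))"
  have "0 < ?\<delta>"
    using assms by auto
  moreover have "?\<delta> \<le> c - f x" if "x \<in> S" for x
    using assms(1) that by (intro Min_le) auto
  ultimately show ?thesis
    by (intro exI[of _ ?\<delta>]) force
qed

lemma (in hypergraph) finite_pverts_split_incidence_graph:
  "finite (pverts (split_incidence_graph V E))"
  by (simp add: pverts_split_incidence_graph finite_verts finite_hyperedge_copies)

lemma (in hypergraph) total_domishold_if_transversal_weights:
  assumes "V \<noteq> {}" and "transversal_weights V E w\<^sub>0 T"
  shows "total_domishold (split_incidence_graph V E)"
proof -
  let ?G = "split_incidence_graph V E"
  define w where "w x = min (w\<^sub>0 x) T" for x
  have "transversal_weights V E w T"
    using transversal_weights_cap[OF finite_verts assms(2)] unfolding w_def .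
  then have w0: "\<And>x. x \<in> V \<Longrightarrow> 0 \<le> w x" and "0 \<le> T"
    and T: "\<And>A. A \<subseteq> V \<Longrightarrow> T \<le> sum w A \<longleftrightarrow> transversal E A"
    unfolding transversal_weights_def by auto
  have wT: "w x \<le> T" for x
    by (simp add: w_def)
  have "\<exists>\<delta>>0. \<forall>A\<in>{A. A \<subseteq> V \<and> \<not> transversal E A}. sum w A \<le> T - \<delta>"
    using finite_verts T by (intro finite_uniform_gap) (auto simp: not_le[symmetric])
  then obtain \<delta> where "0 < \<delta>"
    and gap: "\<And>A. A \<subseteq> V \<Longrightarrow> \<not> transversal E A \<Longrightarrow> sum w A \<le> T - \<delta>"
    by auto
  \<comment> \<open>Small enough that the increments of all vertices together do not exceed the gap.\<close>
  define \<epsilon> where "\<epsilon> = \<delta> / (card (pverts ?G) + 1)"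
  have "0 < \<epsilon>"
    using \<open>0 < \<delta>\<close> by (simp add: \<epsilon>_def)
  have small: "card (pverts ?G) * \<epsilon> \<le> \<delta>"
    using \<open>0 < \<delta>\<close> by (simp add: \<epsilon>_def field_simps)
  define w' where "w' x = case_sum w (\<lambda>_. 0) x + \<epsilon>" for x :: "'a + 'a set \<times> nat"
  have "T + 2 * \<epsilon> \<le> sum w' D \<longleftrightarrow> total_dominating_set ?G D" if D: "D \<subseteq> pverts ?G" for D
  proof -
    let ?A = "Inl -` D"
    have finD: "finite D"
      using D finite_pverts_split_incidence_graph by (rule finite_subset)
    have A: "?A \<subseteq> V"
      using D by (auto simp: pverts_split_incidence_graph)
    have "sum (case_sum w (\<lambda>_. 0)) D = sum (case_sum w (\<lambda>_. 0)) (?A <+> (Inr -` D))"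
      by (simp add: Plus_vimage)
    also have "\<dots> = sum w ?A"
      using finD by (subst sum.Plus) (auto intro: finite_vimageI)
    finally have sum: "sum w' D = sum w ?A + card D * \<epsilon>"
      by (simp add: w'_def sum.distrib)
    consider "\<not> transversal E ?A" | "transversal E ?A" "2 \<le> card D" | "card D < 2"
      by linarith
    then show ?thesis
    proof cases
      case 1
      have "card D * \<epsilon> \<le> card (pverts ?G) * \<epsilon>"
        using \<open>0 < \<epsilon>\<close> card_mono[OF finite_pverts_split_incidence_graph D] by simp
      then have "sum w' D < T + 2 * \<epsilon>"
        using small gap[OF A 1] sum \<open>0 < \<epsilon>\<close> by linarith
      then show ?thesis
        using 1 total_dominating_set_split_incidence_graph[OF assms(1) D] by auto
    next
      case 2
      then have "2 * \<epsilon> \<le> card D * \<epsilon>"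
        using \<open>0 < \<epsilon>\<close> by simp
      then show ?thesis
        using 2 T[OF A] sum total_dominating_set_split_incidence_graph[OF assms(1) D] by auto
    next
      case 3
      have "sum w' D < T + 2 * \<epsilon>"
      proof (cases "D = {}")
        case False
        then obtain x where "D = {x}"
          using 3 finD by (metis One_nat_def card_1_singletonE card_gt_0_iff less_2_cases
              less_numeral_extra(3))
        moreover have "case_sum w (\<lambda>_. 0) x \<le> T"
          using wT \<open>0 \<le> T\<close> by (cases x) auto
        ultimately show ?thesis
          using \<open>0 < \<epsilon>\<close> by (simp add: w'_def)
      qed (use \<open>0 \<le> T\<close> \<open>0 < \<epsilon>\<close> in simp)
      then show ?thesis
        using 3 total_dominating_set_split_incidence_graph[OF assms(1) D] by auto
    qed
  qed
  moreover have "0 \<le> w' x" if "x \<in> pverts ?G" for x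
    using that w0 \<open>0 < \<epsilon>\<close>
    by (auto simp: w'_def pverts_split_incidence_graph intro: add_nonneg_nonneg)
  ultimately show ?thesis
    using \<open>0 \<le> T\<close> \<open>0 < \<epsilon>\<close> unfolding total_domishold_def
    by (intro exI[of _ w'] exI[of _ "T + 2 * \<epsilon>"]) auto
qed

text \<open>
  Evaluating the graph weights on \<open>A\<close> together with all hyperedge copies decides whether \<open>A\<close> is a
  transversal: if it is, then \<open>A\<close> contains a vertex, which with a hyperedge copy makes two.
\<close>
lemma (in hypergraph) transversal_weights_if_total_domishold:
  assumes "V \<noteq> {}" and "E \<noteq> {#}" and "total_domishold (split_incidence_graph V E)"
  shows "\<exists>w T. transversal_weights V E w T"
proof -
  let ?G = "split_incidence_graph V E" and ?C = "hyperedge_copies E"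
  obtain w :: "'a + 'a set \<times> nat \<Rightarrow> real" and t
    where w: "\<And>x. x \<in> pverts ?G \<Longrightarrow> 0 \<le> w x"
    and t: "\<And>S. S \<subseteq> pverts ?G \<Longrightarrow> t \<le> sum w S \<longleftrightarrow> total_dominating_set ?G S"
    using assms(3) unfolding total_domishold_def by blast
  let ?w = "\<lambda>x. w (Inl x)" and ?T = "max 0 (t - (\<Sum>c\<in>?C. w (Inr c)))"
  have w0: "0 \<le> ?w x" if "x \<in> V" for x
    using w that by (auto simp: pverts_split_incidence_graph)
  have "?T \<le> sum ?w A \<longleftrightarrow> transversal E A" if A: "A \<subseteq> V" for A
  proof -
    have finA: "finite A"
      using A finite_verts by (rule finite_subset)
    have sub: "A <+> ?C \<subseteq> pverts ?G"
      using A by (auto simp: pverts_split_incidence_graph)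
    have vim: "Inl -` (A <+> ?C) = A"
      by auto
    have card: "2 \<le> card (A <+> ?C)" if "transversal E A"
    proof -
      have "A \<noteq> {}"
        using that assms(2) unfolding transversal_def by auto
      then have "0 < card A" "0 < card ?C"
        using finA assms(2) by (simp_all add: card_gt_0_iff finite_hyperedge_copies)
      then show ?thesis
        using finA by (simp add: card_Plus finite_hyperedge_copies)
    qed
    have "0 \<le> sum ?w A"
      using w0 A by (intro sum_nonneg) auto
    moreover have "sum w (A <+> ?C) = sum ?w A + (\<Sum>c\<in>?C. w (Inr c))"
      using finA by (simp add: sum.Plus finite_hyperedge_copies)
    ultimately have "?T \<le> sum ?w A \<longleftrightarrow> t \<le> sum w (A <+> ?C)"
      by linarith
    also have "\<dots> \<longleftrightarrow> transversal E A"
      using t[OF sub] total_dominating_set_split_incidence_graph[OF assms(1) sub] vim card by auto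
    finally show ?thesis .
  qed
  then show ?thesis
    using w0 unfolding transversal_weights_def
    by (intro exI[of _ ?w] exI[of _ ?T]) (metis max.cobounded1)
qed

lemma transversal_weights_no_edges: "transversal_weights V {#} (\<lambda>_. 0) 0"
  by (simp add: transversal_weights_def transversal_def)

text \<open>
  Without vertices, \<open>E\<close> contains at most copies of the empty hyperedge, and the graph has no
  arcs. If \<open>E\<close> is empty too, the graph has no vertices and the empty set is total dominating in
  spite of its cardinality, which is why \<open>V \<noteq> {}\<close> is excluded above. If \<open>E\<close> is not empty,
  nothing is a transversal or total dominating, and a bound above the total weight expresses this.
\<close>
lemma (in hypergraph) no_vertices:
  assumes "V = {}"
  shows "transversal_weights V E (\<lambda>_. 0) (if E = {#} then 0 else 1)"
    and "total_domishold (split_incidence_graph V E)"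
proof -
  show "transversal_weights V E (\<lambda>_. 0) (if E = {#} then 0 else 1)"
    using assms by (auto simp: transversal_weights_def transversal_def)
  have "total_dominating_set (split_incidence_graph V E) S \<longleftrightarrow> E = {#}"
    if "S \<subseteq> pverts (split_incidence_graph V E)" for S
    using that assms unfolding total_dominating_set_def
    by (auto simp: split_incidence_graph_def)
  then show "total_domishold (split_incidence_graph V E)"
    unfolding total_domishold_def
    by (intro exI[of _ "\<lambda>_. 0"] exI[of _ "if E = {#} then 0 else 1"]) auto
qed

theorem proposition4p3:
  fixes V :: "'a set" and E :: "'a set multiset"
  assumes "hypergraph V E"
  shows "threshold_hypergraph V E \<longleftrightarrow> total_domishold (split_incidence_graph V E)"
proof -
  interpret hypergraph V E
    by (rule assms)
  show ?thesis
  proof (cases "V = {}")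
    case True
    then show ?thesis
      using no_vertices threshold_hypergraph_iff_transversal_weights by blast
  next
    case False
    then show ?thesis
      using total_domishold_if_transversal_weights transversal_weights_if_total_domishold
        transversal_weights_no_edges threshold_hypergraph_iff_transversal_weights by metis
  qed
qed

end
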